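(* Let $s_1,s_2>0$ with $s_1\ne s_2$. As $n\to\infty$: (1) if $\mathbf{e}^\top\boldsymbol\Sigma\mathbf{e}\neq 0$, where $\mathbf{e}=(1,1,\dots,1)^\top\in\mathbb{R}^p$, and $\hat{\boldsymbol\Sigma}$ is computed with the plug-in $\hat\alpha=\hat\alpha^p$, then $$\begin{pmatrix}\hat\alpha^p\\ \hat{\boldsymbol\Sigma}_d\\ \hat{\boldsymbol\Sigma}_{nd}\end{pmatrix}\xrightarrow{a.s.}\begin{pmatrix}\alpha\\ \boldsymbol\Sigma_d\\ \boldsymbol\Sigma_{nd}\end{pmatrix};$$ (2) if $\boldsymbol\Sigma_{kk}\ne0$ for all $k=1,\dots,p$, and $\hat{\boldsymbol\Sigma}$ is computed with the plug-in $\hat\alpha=\hat\alpha^{mult}$, then $$\begin{pmatrix}\hat\alpha^{mult}\\ \hat{\boldsymbol\Sigma}_d\\ \hat{\boldsymbol\Sigma}_{nd}\end{pmatrix}\xrightarrow{a.s.}\begin{pmatrix}\alpha\\ \boldsymbol\Sigma_d\\ \boldsymbol\Sigma_{nd}\end{pmatrix}.$$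
   Context: Let $p\ge 1$, $0<\alpha<2$, $\boldsymbol\mu\in\mathbb{R}^p$, and let $\boldsymbol\Sigma$ be a real symmetric positive semi-definite $p\times p$ matrix. The $p$-dimensional sub-Gaussian stable distribution $S_p(\boldsymbol\mu,\boldsymbol\Sigma,\alpha)$ is the law on $\mathbb{R}^p$ with characteristic function $$\phi(\mathbf{t})=\mathbb{E}[e^{i\mathbf{t}^\top\mathbf{x}}]=\exp\Big(i\mathbf{t}^\top\boldsymbol\mu-\big(\tfrac12\mathbf{t}^\top\boldsymbol\Sigma\mathbf{t}\big)^{\alpha/2}\Big),\quad \mathbf{t}\in\mathbb{R}^p.$$ Let $\mathbf{x}_1,\mathbf{x}_2,\dots$ be i.i.d. with law $S_p(\boldsymbol\mu,\boldsymbol\Sigma,\alpha)$. The empirical characteristic function is $\hat\phi_n(\mathbf{t})=\frac1n\sum_{j=1}^n e^{i\mathbf{t}^\top\mathbf{x}_j}$. Let $\mathbf{e}_k\in\mathbb{R}^p$ be the $k$-th standard basis vector and $\mathbf{e}=(1,\dots,1)^\top$. Estimators of $\alpha$: $$\hat\alpha^p:=\frac{1}{\log|s_1/s_2|}\log\left[\frac{\log|\hat\phi_n(s_1\mathbf{e})|}{\log|\hat\phi_n(s_2\mathbf{e})|}\right],\quad \hat\alpha_s(k):=\frac{1}{\log|s_1/s_2|}\log\left[\frac{\log|\hat\phi_n(s_1\mathbf{e}_k)|}{\log|\hat\phi_n(s_2\mathbf{e}_k)|}\right],\quad \hat\alpha^{mult}:=\frac1p\sum_{k=1}^p\hat\alpha_s(k).$$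 Estimators of the entries of $\boldsymbol\Sigma$, given a plug-in estimator $\hat\alpha$ and nonzero real scalars $\sigma_1,\dots,\sigma_p$ (arbitrary and fixed): $$[\hat{\boldsymbol\Sigma}]_{ii}:=\frac{2}{\sigma_i^2}\big(-\log|\hat\phi_n(\sigma_i\mathbf{e}_i)|\big)^{2/\hat\alpha}\ (i\le p),$$ $$[\hat{\boldsymbol\Sigma}]_{ij}:=\tfrac12\Big(\big[-\log|\hat\phi_n(\mathbf{e}_i+\mathbf{e}_j)|\big]^{2/\hat\alpha}-\big[-\log|\hat\phi_n(\mathbf{e}_i-\mathbf{e}_j)|\big]^{2/\hat\alpha}\Big)\ (1\le j<i\le p).$$ For a $p\times p$ matrix $M$, $M_d\in\mathbb{R}^p$ is the vector of its diagonal entries, $M_d[i]=M_{ii}$, and $M_{nd}\in\mathbb{R}^{p(p-1)/2}$ is the vector of its entries below the diagonal stacked row by row: $M_{nd}[\#(i,j)]=M_{ij}$ with $\#(i,j)=\frac{i(i-1)}{2}-(i-1)+j$ for $2\le i\le p$, $1\le j\le i-1$. This defines $\boldsymbol\Sigma_d,\boldsymbol\Sigma_{nd},\hat{\boldsymbol\Sigma}_d,\hat{\boldsymbol\Sigma}_{nd}$. *)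

theory Defs
  imports "HOL-Probability.Probability"
begin

text \<open>
  Vectors in \<open>\<real>\<^sup>p\<close> are elements of \<^typ>\<open>real ^ 'p\<close>, with \<open>p = CARD('p)\<close>.  The
  linear order on the index type serves only to number the coordinates from 1 to \<open>p\<close>.
\<close>

definition psd_matrix :: "real ^ 'p ^ 'p \<Rightarrow> bool" where
  "psd_matrix S \<longleftrightarrow> transpose S = S \<and> (\<forall>v. 0 \<le> v \<bullet> (S *v v))"

definition cf :: "(real ^ 'p::finite) measure \<Rightarrow> real ^ 'p \<Rightarrow> complex" where
  "cf L t = (CLINT x|L. iexp (t \<bullet> x))"

definition sub_gaussian_stable ::
    "real ^ 'p \<Rightarrow> real ^ 'p ^ 'p \<Rightarrow> real \<Rightarrow> (real ^ 'p::finite) measure \<Rightarrow> bool" where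
  "sub_gaussian_stable \<mu> S \<alpha> L \<longleftrightarrow>
     prob_space L \<and> sets L = sets borel \<and>
     (\<forall>t. cf L t =
        exp (\<i> * complex_of_real (t \<bullet> \<mu>)
             - complex_of_real ((1 / 2 * (t \<bullet> (S *v t))) powr (\<alpha> / 2))))"

text \<open>The sample is \<open>X 1, X 2, \<dots>\<close>; the value \<open>X 0\<close> is not used.\<close>

definition ecf :: "(nat \<Rightarrow> 'a \<Rightarrow> real ^ 'p) \<Rightarrow> nat \<Rightarrow> 'a \<Rightarrow> real ^ 'p::finite \<Rightarrow> complex" where
  "ecf X n \<omega> t = 1 / of_nat n * (\<Sum>j = 1..n. iexp (t \<bullet> X j \<omega>))"

abbreviation std_basis :: "'p \<Rightarrow> real ^ 'p::finite" where
  "std_basis k \<equiv> axis k 1"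

definition ones :: "real ^ 'p::finite" where
  "ones = (\<chi> i. 1)"

text \<open>
  The estimators below are functionals of a function \<open>\<phi>\<close>, to be instantiated with the
  empirical characteristic function \<open>ecf X n \<omega>\<close>.  For samples on which a formula is not
  meaningful (e.g. \<open>\<phi>\<close> vanishes at an evaluation point, or a quotient of logarithms has
  denominator 0) the value is the one given by the library conventions for \<open>ln\<close>,
  \<open>/\<close> and \<open>powr\<close> outside their natural domains.
\<close>

definition alpha_along ::
    "real \<Rightarrow> real \<Rightarrow> (real ^ 'p \<Rightarrow> complex) \<Rightarrow> real ^ 'p::finite \<Rightarrow> real" where
  "alpha_along s1 s2 \<phi> u =
     1 / ln \<bar>s1 / s2\<bar> * ln (ln (cmod (\<phi> (s1 *\<^sub>R u))) / ln (cmod (\<phi> (s2 *\<^sub>R u))))"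

definition alpha_p :: "real \<Rightarrow> real \<Rightarrow> (real ^ 'p::finite \<Rightarrow> complex) \<Rightarrow> real" where
  "alpha_p s1 s2 \<phi> = alpha_along s1 s2 \<phi> ones"

definition alpha_s :: "real \<Rightarrow> real \<Rightarrow> (real ^ 'p::finite \<Rightarrow> complex) \<Rightarrow> 'p \<Rightarrow> real" where
  "alpha_s s1 s2 \<phi> k = alpha_along s1 s2 \<phi> (std_basis k)"

definition alpha_mult :: "real \<Rightarrow> real \<Rightarrow> (real ^ 'p::finite \<Rightarrow> complex) \<Rightarrow> real" where
  "alpha_mult s1 s2 \<phi> = 1 / real CARD('p) * (\<Sum>k\<in>UNIV. alpha_s s1 s2 \<phi> k)"

text \<open>
  Only the entries on and below the diagonal of the estimator of the scale matrix are ever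
  used; above the diagonal the off-diagonal formula is used as well, which for an empirical
  characteristic function gives the symmetric matrix, since \<open>\<bar>\<phi>(-t)\<bar> = \<bar>\<phi>(t)\<bar>\<close>.
\<close>

definition Sigma_hat ::
    "('p \<Rightarrow> real) \<Rightarrow> real \<Rightarrow> (real ^ 'p \<Rightarrow> complex) \<Rightarrow> real ^ 'p ^ 'p::finite" where
  "Sigma_hat \<sigma> a \<phi> = (\<chi> i j.
     if i = j then 2 / (\<sigma> i)\<^sup>2 * (- ln (cmod (\<phi> (\<sigma> i *\<^sub>R std_basis i)))) powr (2 / a)
     else 1 / 2 * ((- ln (cmod (\<phi> (std_basis i + std_basis j)))) powr (2 / a)
                 - (- ln (cmod (\<phi> (std_basis i - std_basis j)))) powr (2 / a)))"

definition diag_vec :: "real ^ 'p ^ 'p \<Rightarrow> real ^ 'p::finite" where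
  "diag_vec M = (\<chi> i. M $ i $ i)"

definition coord_num :: "'p::{finite,linorder} \<Rightarrow> nat" where
  "coord_num i = card {k. k \<le> i}"

definition nd_num :: "'p::{finite,linorder} \<Rightarrow> 'p \<Rightarrow> nat" where
  "nd_num i j =
     coord_num i * (coord_num i - 1) div 2 - (coord_num i - 1) + coord_num j"

text \<open>
  A vector of length \<open>p (p - 1) / 2\<close>, which may be 0, is encoded as a function
  on \<^typ>\<open>nat\<close> that vanishes outside \<open>{1..p (p - 1) / 2}\<close>; the topology on functions is
  that of pointwise convergence.  The sum has at most one term, see \<open>nd_vec_nd_num\<close> and
  \<open>nd_vec_outside\<close>.
\<close>

definition nd_vec :: "real ^ 'p::{finite,linorder} ^ 'p::{finite,linorder} \<Rightarrow> nat \<Rightarrow> real" where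
  "nd_vec M m = (\<Sum>(i, j) | j < i \<and> nd_num i j = m. M $ i $ j)"

lemma coord_num_range: "1 \<le> coord_num i" "coord_num i \<le> CARD('p)"
  for i :: "'p::{finite,linorder}"
proof -
  have "card {i} \<le> card {k. k \<le> i}" by (rule card_mono) auto
  then show "1 \<le> coord_num i" by (simp add: coord_num_def)
  show "coord_num i \<le> CARD('p)" unfolding coord_num_def by (rule card_mono) auto
qed

lemma coord_num_strict_mono: "i < j \<Longrightarrow> coord_num i < coord_num j"
  unfolding coord_num_def
  by (rule psubset_card_mono) (auto simp: psubset_eq set_eq_iff not_le intro!: exI[of _ j])

lemma coord_num_bij: "bij_betw coord_num (UNIV :: 'p::{finite,linorder} set) {1..CARD('p)}"
proof -
  have inj: "inj (coord_num :: 'p \<Rightarrow> nat)"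
    by (rule injI) (metis coord_num_strict_mono less_irrefl linorder_less_linear)
  have "range (coord_num :: 'p \<Rightarrow> nat) = {1..CARD('p)}"
  proof (rule card_subset_eq)
    show "range (coord_num :: 'p \<Rightarrow> nat) \<subseteq> {1..CARD('p)}"
      using coord_num_range by fastforce
    show "card (range (coord_num :: 'p \<Rightarrow> nat)) = card {1..CARD('p)}"
      using card_image[OF inj] by simp
  qed simp
  with inj show ?thesis by (simp add: bij_betw_def)
qed

lemma triangle_Suc: "Suc m * (Suc m - 1) div 2 = m * (m - 1) div 2 + (m::nat)"
proof (cases m)
  case (Suc k)
  have "Suc m * (Suc m - 1) = m * (m - 1) + m * 2" by (simp add: Suc algebra_simps)
  then show ?thesis by simp
qed simp

lemma triangle_mono: "m \<le> n \<Longrightarrow> m * (m - 1) div 2 \<le> n * (n - 1) div (2::nat)"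
  by (intro div_le_mono mult_le_mono) auto

lemma nd_num_bounds:
  assumes "j < i"
  defines "m \<equiv> coord_num i - 1"
  shows "nd_num i j = m * (m - 1) div 2 + coord_num j" "1 \<le> coord_num j" "coord_num j \<le> m"
proof -
  have i: "coord_num i = Suc m" using coord_num_range(1)[of i] by (simp add: m_def)
  show "nd_num i j = m * (m - 1) div 2 + coord_num j"
    unfolding nd_num_def i triangle_Suc by simp
  show "1 \<le> coord_num j" by (rule coord_num_range)
  show "coord_num j \<le> m" using coord_num_strict_mono[OF assms(1)] i by simp
qed

lemma nd_num_inj:
  assumes "j < i" "j' < i'" "nd_num i j = nd_num i' j'"
  shows "i = i' \<and> j = j'"
proof -
  have inj: "coord_num x = coord_num y \<Longrightarrow> x = y" for x y :: 'a
    by (metis coord_num_strict_mono less_irrefl linorder_less_linear)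
  have *: "coord_num y \<le> coord_num x" if "b < x" "d < y" "nd_num x b = nd_num y d" for x y b d :: 'a
  proof (rule ccontr)
    assume "\<not> ?thesis"
    then have lt: "Suc (coord_num x - 1) \<le> coord_num y - 1"
      using coord_num_range(1)[of x] by simp
    show False
      using triangle_mono[OF lt] triangle_Suc[of "coord_num x - 1"]
        nd_num_bounds[OF that(1)] nd_num_bounds[OF that(2)] that(3) by linarith
  qed
  have "coord_num i = coord_num i'"
    using *[OF assms] *[OF assms(2,1) assms(3)[symmetric]] by simp
  then show ?thesis
    using nd_num_bounds(1)[OF assms(1)] nd_num_bounds(1)[OF assms(2)] assms(3) inj by simp
qed

lemma nd_num_range:
  fixes i j :: "'p::{finite,linorder}"
  assumes "j < i"
  shows "nd_num i j \<in> {1..CARD('p) * (CARD('p) - 1) div 2}"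
proof -
  have "Suc (coord_num i - 1) \<le> CARD('p)"
    using coord_num_range[of i] by simp
  from triangle_mono[OF this] triangle_Suc[of "coord_num i - 1"] nd_num_bounds[OF assms]
  show ?thesis unfolding atLeastAtMost_iff by linarith
qed

lemma nd_vec_nd_num:
  assumes "j < i"
  shows "nd_vec M (nd_num i j) = M $ i $ j"
proof -
  have "{(i', j'). j' < i' \<and> nd_num i' j' = nd_num i j} = {(i, j)}"
    using nd_num_inj assms by blast
  then show ?thesis unfolding nd_vec_def by simp
qed

lemma nd_vec_outside:
  fixes M :: "real ^ 'p::{finite,linorder} ^ 'p::{finite,linorder}"
  assumes "m \<notin> {1..CARD('p) * (CARD('p) - 1) div 2}"
  shows "nd_vec M m = 0"
proof -
  have "{(i, j). j < i \<and> nd_num i j = m} = ({} :: ('p \<times> 'p) set)"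
    using nd_num_range assms by blast
  then show ?thesis unfolding nd_vec_def by (simp only: sum.empty)
qed

end

theory Submission
  imports Defs
begin

text \<open>
  All estimators are functions of the empirical characteristic function at finitely many
  points, and the population characteristic function recovers the parameters exactly. With
  \<open>g t = (1/2 t \<bullet> S t) powr (\<alpha>/2)\<close> (below \<open>stable_exponent\<close>) the law satisfies
  \<open>- ln \<bar>\<phi> t\<bar> = g t\<close>, so the location drops out. Since \<open>g (s u) = s powr \<alpha> * g u\<close> for \<open>s > 0\<close>, the
  ratio of two logarithms along a direction \<open>u\<close> with \<open>u \<bullet> S u > 0\<close> is \<open>(s1/s2) powr \<alpha>\<close>, which
  yields \<open>\<alpha>\<close>. Since \<open>g t powr (2/\<alpha>)\<close> is half of the quadratic form of \<open>S\<close>, the diagonal entries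
  come from basis vectors and the off-diagonal ones from the polarization identity.

  Consistency is then the strong law together with continuity. The summands
  \<open>exp (\<i> t \<bullet> X j)\<close> are bounded, so Hoeffding's inequality makes the deviation probabilities
  of their means summable, and the strong law follows from the Borel--Cantelli lemma
  (\<open>strong_law_bounded\<close>). Outside one null set the empirical characteristic function
  converges at all points used, and the rest is deterministic (\<open>alpha_along_tendsto\<close>,
  \<open>Sigma_hat_tendsto\<close>). The only delicate point of the continuity argument is
  that \<open>S\<close> may be singular: then \<open>x powr y\<close> is needed at \<open>x = 0\<close>, where it is continuous from
  \<open>x \<ge> 0\<close> only, for exponents with positive limit. The empirical characteristic function is bounded by 1,
  which keeps its negated log-modulus on that side.
\<close>

section \<open>Strong law for the empirical characteristic function\<close>

text \<open>
  For fixed \<open>\<epsilon>\<close>, Hoeffding's inequality bounds the probability that the mean of \<open>n\<close> terms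
  is off by \<open>\<epsilon>\<close> by a geometric sequence in \<open>n\<close>, so by Borel--Cantelli almost surely only
  finitely many such deviations occur; then \<open>\<epsilon>\<close> runs through \<open>1/(k+1)\<close>.
\<close>

lemma (in prob_space) strong_law_bounded:
  fixes Z :: "nat \<Rightarrow> 'a \<Rightarrow> real"
  assumes indep: "indep_vars (\<lambda>_. borel) Z {1..}"
    and bounded: "\<And>j. j \<ge> 1 \<Longrightarrow> AE x in M. Z j x \<in> {a..b}"
    and "a < b"
    and mean: "\<And>j. j \<ge> 1 \<Longrightarrow> expectation (Z j) = m"
  shows "AE x in M. (\<lambda>n. (\<Sum>j=1..n. Z j x) / n) \<longlonglongrightarrow> m"
proof -
  have [measurable]: "random_variable borel (Z j)" if "j \<ge> 1" for j
    using indep that unfolding indep_vars_def by auto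
  \<comment> \<open>The inequality is multiplied by \<open>n\<close> to match the form of Hoeffding's inequality for sums.\<close>
  define bad where
    "bad \<epsilon> n = {x\<in>space M. real n * \<epsilon> \<le> \<bar>(\<Sum>j=1..n. Z j x) - n * m\<bar>}" for \<epsilon> :: real and n
  have [measurable]: "bad \<epsilon> n \<in> sets M" for \<epsilon> n
  proof -
    have [measurable]: "(\<lambda>x. \<Sum>j=1..n. Z j x) \<in> borel_measurable M"
      by (rule borel_measurable_sum) simp
    show ?thesis unfolding bad_def by measurable
  qed
  have bad_prob: "prob (bad \<epsilon> n) \<le> 2 * exp (- 2 * \<epsilon>\<^sup>2 / (b - a)\<^sup>2) ^ n"
    if "\<epsilon> > 0" for \<epsilon> n
  proof (cases "n = 0")
    case True
    show ?thesis by (rule order_trans[OF prob_le_1]) (simp add: True)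
  next
    case False
    interpret H: Hoeffding_ineq M "{1..n}" Z "\<lambda>_. a" "\<lambda>_. b" "\<Sum>j=1..n. expectation (Z j)"
      by unfold_locales (use bounded in \<open>auto intro: indep_vars_subset[OF indep]\<close>)
    have "prob (bad \<epsilon> n) \<le> 2 * exp (- 2 * (n * \<epsilon>)\<^sup>2 / (\<Sum>j=1..n. (b - a)\<^sup>2))"
      using H.Hoeffding_ineq_abs_ge[of "n * \<epsilon>"] False \<open>a < b\<close> that by (simp add: mean bad_def)
    also have "- 2 * (n * \<epsilon>)\<^sup>2 / (\<Sum>j=1..n. (b - a)\<^sup>2) = n * (- 2 * \<epsilon>\<^sup>2 / (b - a)\<^sup>2)"
      using False by (simp add: power2_eq_square)
    finally show ?thesis by (simp only: exp_of_nat_mult)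
  qed
  have close: "AE x in M. \<forall>\<^sub>F n in sequentially. x \<in> space M - bad \<epsilon> n" if "\<epsilon> > 0" for \<epsilon>
  proof (rule borel_cantelli_AE1)
    show "summable (\<lambda>n. prob (bad \<epsilon> n))"
    proof (rule summable_comparison_test')
      have "exp (- 2 * \<epsilon>\<^sup>2 / (b - a)\<^sup>2) < 1"
        using that \<open>a < b\<close> by simp
      then show "summable (\<lambda>n. 2 * exp (- 2 * \<epsilon>\<^sup>2 / (b - a)\<^sup>2) ^ n)"
        by (intro summable_mult summable_geometric) simp
      show "norm (prob (bad \<epsilon> n)) \<le> 2 * exp (- 2 * \<epsilon>\<^sup>2 / (b - a)\<^sup>2) ^ n" for n
        using bad_prob[OF that] by simp
    qed
  qed (simp_all add: emeasure_eq_measure)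
  have "AE x in M. \<forall>k. \<forall>\<^sub>F n in sequentially. x \<in> space M - bad (1 / Suc k) n"
    unfolding AE_all_countable by (intro allI close) simp
  then show ?thesis
  proof (rule AE_mp, intro AE_I2 impI)
    fix x
    assume x: "\<forall>k. \<forall>\<^sub>F n in sequentially. x \<in> space M - bad (1 / Suc k) n"
    show "(\<lambda>n. (\<Sum>j=1..n. Z j x) / n) \<longlonglongrightarrow> m"
    proof (rule tendstoI)
      fix e :: real assume "e > 0"
      then obtain k where k: "1 / Suc k < e"
        using nat_approx_posE by metis
      show "\<forall>\<^sub>F n in sequentially. dist ((\<Sum>j=1..n. Z j x) / n) m < e"
        using x[rule_format, of k] eventually_gt_at_top[of 0]
      proof eventually_elim
        case (elim n)
        have "(\<Sum>j=1..n. Z j x) / n - m = ((\<Sum>j=1..n. Z j x) - n * m) / n"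
          using elim by (simp add: field_simps)
        also have "\<bar>\<dots>\<bar> < 1 / Suc k"
          using elim by (auto simp: bad_def abs_divide field_simps)
        finally show ?case using k by (simp add: dist_real_def)
      qed
    qed
  qed
qed

text \<open>
  The real and the imaginary part of \<open>exp (\<i> t \<bullet> X j)\<close> are a cosine and a sine, hence
  bounded, and inherit independence from \<open>X\<close>.
\<close>

lemma (in prob_space) ecf_tendsto_cf:
  fixes X :: "nat \<Rightarrow> 'a \<Rightarrow> real ^ 'p::finite"
  assumes indep: "indep_vars (\<lambda>_. borel) X {1..}"
    and distr: "\<And>j. j \<ge> 1 \<Longrightarrow> distr M borel (X j) = L"
  shows "AE \<omega> in M. (\<lambda>n. ecf X n \<omega> t) \<longlonglongrightarrow> cf L t"
proof -
  have [measurable]: "random_variable borel (X j)" if "j \<ge> 1" for j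
    using indep that unfolding indep_vars_def by auto
  have cf: "integrable M (\<lambda>\<omega>. iexp (t \<bullet> X j \<omega>))" "expectation (\<lambda>\<omega>. iexp (t \<bullet> X j \<omega>)) = cf L t"
    if "j \<ge> 1" for j
  proof -
    show "integrable M (\<lambda>\<omega>. iexp (t \<bullet> X j \<omega>))"
      by (rule integrable_const_bound[where B = 1]) (use that in auto)
    show "expectation (\<lambda>\<omega>. iexp (t \<bullet> X j \<omega>)) = cf L t"
      unfolding cf_def distr[OF that, symmetric] by (subst integral_distr) (use that in auto)
  qed
  have "AE \<omega> in M. (\<lambda>n. (\<Sum>j=1..n. cos (t \<bullet> X j \<omega>)) / n) \<longlonglongrightarrow> Re (cf L t)"
  proof (rule strong_law_bounded[where a = "-1" and b = 1])
    show "indep_vars (\<lambda>_. borel) (\<lambda>j \<omega>. cos (t \<bullet> X j \<omega>)) {1..}"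
      by (rule indep_vars_compose2[OF indep]) simp
    show "expectation (\<lambda>\<omega>. cos (t \<bullet> X j \<omega>)) = Re (cf L t)" if "j \<ge> 1" for j
      using integral_Re[OF cf(1)[OF that]] by (simp add: cf(2)[OF that] Re_exp)
  qed auto
  moreover have "AE \<omega> in M. (\<lambda>n. (\<Sum>j=1..n. sin (t \<bullet> X j \<omega>)) / n) \<longlonglongrightarrow> Im (cf L t)"
  proof (rule strong_law_bounded[where a = "-1" and b = 1])
    show "indep_vars (\<lambda>_. borel) (\<lambda>j \<omega>. sin (t \<bullet> X j \<omega>)) {1..}"
      by (rule indep_vars_compose2[OF indep]) simp
    show "expectation (\<lambda>\<omega>. sin (t \<bullet> X j \<omega>)) = Im (cf L t)" if "j \<ge> 1" for j
      using integral_Im[OF cf(1)[OF that]] by (simp add: cf(2)[OF that] Im_exp)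
  qed auto
  moreover have "Re (ecf X n \<omega> t) = (\<Sum>j=1..n. cos (t \<bullet> X j \<omega>)) / n"
      "Im (ecf X n \<omega> t) = (\<Sum>j=1..n. sin (t \<bullet> X j \<omega>)) / n" for n \<omega>
    by (simp_all add: ecf_def Re_divide_of_nat Im_divide_of_nat Re_exp Im_exp)
  ultimately show ?thesis
    by (auto simp: tendsto_complex_iff)
qed

lemma norm_ecf_le_1: "cmod (ecf X n \<omega> t) \<le> 1"
proof -
  have "cmod (\<Sum>j=1..n. iexp (t \<bullet> X j \<omega>)) \<le> (\<Sum>j=1..n. 1)"
    by (rule sum_norm_le) simp
  then show ?thesis
    by (cases "n = 0") (simp_all add: ecf_def norm_divide)
qed

section \<open>The exponent of a sub-Gaussian stable law\<close>

definition stable_exponent :: "real ^ 'p ^ 'p \<Rightarrow> real \<Rightarrow> real ^ 'p::finite \<Rightarrow> real" where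
  "stable_exponent S \<alpha> t = (1 / 2 * (t \<bullet> (S *v t))) powr (\<alpha> / 2)"

text \<open>
  Taking the modulus removes the location parameter. The limit of the modulus is an
  exponential, hence nonzero, so the logarithm is continuous there.
\<close>

lemma neg_ln_norm_tendsto_stable_exponent:
  assumes "sub_gaussian_stable \<mu> S \<alpha> L" "(\<lambda>n. \<phi> n t) \<longlonglongrightarrow> cf L t"
  shows "(\<lambda>n. - ln (cmod (\<phi> n t))) \<longlonglongrightarrow> stable_exponent S \<alpha> t"
proof -
  have "cmod (cf L t) = exp (- stable_exponent S \<alpha> t)"
    using assms(1) by (simp add: sub_gaussian_stable_def stable_exponent_def)
  then have "(\<lambda>n. cmod (\<phi> n t)) \<longlonglongrightarrow> exp (- stable_exponent S \<alpha> t)"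
    using tendsto_norm[OF assms(2)] by simp
  from tendsto_minus[OF tendsto_ln[OF this]] show ?thesis by simp
qed

lemma stable_exponent_powr:
  assumes "psd_matrix S" "0 < \<alpha>"
  shows "stable_exponent S \<alpha> t powr (2 / \<alpha>) = 1 / 2 * (t \<bullet> (S *v t))"
  using assms by (simp add: stable_exponent_def powr_powr psd_matrix_def)

lemma quadratic_form_scaleR:
  fixes S :: "real ^ 'p ^ 'p::finite"
  shows "(c *\<^sub>R u) \<bullet> (S *v (c *\<^sub>R u)) = c\<^sup>2 * (u \<bullet> (S *v u))"
  by (simp add: matrix_vector_mult_scaleR power2_eq_square)

lemma quadratic_form_std_basis:
  fixes S :: "real ^ 'p ^ 'p::finite"
  shows "std_basis i \<bullet> (S *v std_basis j) = S $ i $ j"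
  by (simp add: inner_axis' matrix_vector_mul_component inner_axis)

section \<open>Consistency of the estimators as functionals\<close>

text \<open>
  The exponent is homogeneous of degree \<open>\<alpha>\<close>, so its unknown value in direction \<open>u\<close> cancels
  in the ratio, which tends to \<open>(s1 / s2) powr \<alpha>\<close>. Non-degeneracy in direction \<open>u\<close> keeps the
  denominator away from 0.
\<close>

lemma alpha_along_tendsto:
  assumes "psd_matrix S" "u \<bullet> (S *v u) \<noteq> 0" "0 < s1" "0 < s2" "s1 \<noteq> s2"
    and lim: "\<And>s. s \<in> {s1, s2} \<Longrightarrow>
      (\<lambda>n. - ln (cmod (\<phi> n (s *\<^sub>R u)))) \<longlonglongrightarrow> stable_exponent S \<alpha> (s *\<^sub>R u)"
  shows "(\<lambda>n. alpha_along s1 s2 (\<phi> n) u) \<longlonglongrightarrow> \<alpha>"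
proof -
  define q where "q = stable_exponent S \<alpha> u"
  have q: "q > 0"
    using assms(1,2) by (simp add: q_def stable_exponent_def psd_matrix_def order_less_le)
  have exponent: "stable_exponent S \<alpha> (s *\<^sub>R u) = s powr \<alpha> * q" if "0 < s" for s
  proof -
    have "stable_exponent S \<alpha> (s *\<^sub>R u) = (s\<^sup>2 * (1 / 2 * (u \<bullet> (S *v u)))) powr (\<alpha> / 2)"
      unfolding stable_exponent_def quadratic_form_scaleR by (simp only: mult.left_commute)
    also have "\<dots> = s\<^sup>2 powr (\<alpha> / 2) * q"
      unfolding q_def stable_exponent_def by (rule powr_mult)
    also have "s\<^sup>2 powr (\<alpha> / 2) = s powr \<alpha>"
      using that powr_powr[of s 2 "\<alpha> / 2"] by (simp add: powr_numeral)
    finally show ?thesis .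
  qed
  have "(\<lambda>n. ln ((- ln (cmod (\<phi> n (s1 *\<^sub>R u)))) / (- ln (cmod (\<phi> n (s2 *\<^sub>R u))))))
      \<longlonglongrightarrow> ln ((s1 powr \<alpha> * q) / (s2 powr \<alpha> * q))"
    using lim[of s1] lim[of s2] q assms(3,4) by (intro tendsto_intros) (auto simp: exponent)
  also have "(s1 powr \<alpha> * q) / (s2 powr \<alpha> * q) = (s1 / s2) powr \<alpha>"
    using q assms(3,4) by (simp add: powr_divide)
  also have "ln \<dots> = \<alpha> * ln (s1 / s2)"
    using assms(3,4) by (simp add: ln_powr)
  finally have "(\<lambda>n. 1 / ln \<bar>s1 / s2\<bar> * ln (ln (cmod (\<phi> n (s1 *\<^sub>R u))) / ln (cmod (\<phi> n (s2 *\<^sub>R u)))))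
      \<longlonglongrightarrow> 1 / ln \<bar>s1 / s2\<bar> * (\<alpha> * ln (s1 / s2))"
    by (intro tendsto_mult tendsto_const) simp
  moreover have "ln (s1 / s2) \<noteq> 0"
    using assms(3-5) by (simp add: ln_div)
  ultimately show ?thesis
    using assms(3,4) by (simp add: alpha_along_def)
qed

lemma alpha_mult_tendsto:
  fixes \<phi> :: "nat \<Rightarrow> real ^ 'p::finite \<Rightarrow> complex"
  assumes "\<And>k. (\<lambda>n. alpha_along s1 s2 (\<phi> n) (std_basis k)) \<longlonglongrightarrow> \<alpha>"
  shows "(\<lambda>n. alpha_mult s1 s2 (\<phi> n)) \<longlonglongrightarrow> \<alpha>"
proof -
  have "(\<lambda>n. alpha_mult s1 s2 (\<phi> n)) \<longlonglongrightarrow> 1 / real CARD('p) * (\<Sum>k\<in>(UNIV::'p set). \<alpha>)"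
    unfolding alpha_mult_def alpha_s_def by (intro tendsto_intros assms)
  then show ?thesis by simp
qed

text \<open>
  Each power in the estimator tends to half of the quadratic form of \<open>S\<close> at the
  evaluation point; polarization turns the difference of two of them into an off-diagonal
  entry. For singular \<open>S\<close> the base of a power may tend to 0; the bound on \<open>\<phi>\<close> keeps the base
  nonnegative, which makes \<^const>\<open>powr\<close> continuous there.
\<close>

lemma Sigma_hat_tendsto:
  fixes S :: "real ^ 'p ^ 'p::finite"
  assumes S: "psd_matrix S" and "0 < \<alpha>" and a: "a \<longlonglongrightarrow> \<alpha>"
    and \<sigma>: "\<And>i. \<sigma> i \<noteq> 0"
    and le_1: "\<And>n t. cmod (\<phi> n t) \<le> 1"
    and lim: "\<And>t. t \<in> range (\<lambda>i. \<sigma> i *\<^sub>R std_basis i)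
        \<union> range (\<lambda>(i, j). std_basis i + std_basis j) \<union> range (\<lambda>(i, j). std_basis i - std_basis j)
      \<Longrightarrow> (\<lambda>n. - ln (cmod (\<phi> n t))) \<longlonglongrightarrow> stable_exponent S \<alpha> t"
  shows "(\<lambda>n. Sigma_hat \<sigma> (a n) (\<phi> n) $ i $ j) \<longlonglongrightarrow> S $ i $ j"
proof -
  have power: "(\<lambda>n. (- ln (cmod (\<phi> n t))) powr (2 / a n)) \<longlonglongrightarrow> 1 / 2 * (t \<bullet> (S *v t))"
    if "(\<lambda>n. - ln (cmod (\<phi> n t))) \<longlonglongrightarrow> stable_exponent S \<alpha> t" for t
    unfolding stable_exponent_powr[OF S \<open>0 < \<alpha>\<close>, symmetric]
  proof (rule tendsto_powr'[OF that])
    show "(\<lambda>n. 2 / a n) \<longlonglongrightarrow> 2 / \<alpha>"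
      using \<open>0 < \<alpha>\<close> by (intro tendsto_intros a) simp
    \<comment> \<open>If \<open>\<phi> n t\<close> vanishes, the value is \<open>ln 0 = 0\<close>.\<close>
    have "0 \<le> - ln (cmod (\<phi> n t))" for n
      using le_1[of n t] by (cases "\<phi> n t = 0") simp_all
    then show "stable_exponent S \<alpha> t \<noteq> 0 \<or> 0 < 2 / \<alpha> \<and> (\<forall>\<^sub>F n in sequentially. 0 \<le> - ln (cmod (\<phi> n t)))"
      using \<open>0 < \<alpha>\<close> by simp
  qed
  show ?thesis
  proof (cases "i = j")
    case True
    have "(\<lambda>n. 2 / (\<sigma> i)\<^sup>2 * (- ln (cmod (\<phi> n (\<sigma> i *\<^sub>R std_basis i)))) powr (2 / a n))
        \<longlonglongrightarrow> 2 / (\<sigma> i)\<^sup>2 * (1 / 2 * ((\<sigma> i *\<^sub>R std_basis i) \<bullet> (S *v (\<sigma> i *\<^sub>R std_basis i))))"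
      by (intro tendsto_intros power lim) auto
    then show ?thesis
      using True \<sigma>[of i]
      by (simp add: Sigma_hat_def quadratic_form_scaleR quadratic_form_std_basis
        del: inner_scaleR_left inner_scaleR_right)
  next
    case False
    let ?p = "std_basis i + std_basis j" and ?m = "std_basis i - std_basis j"
    have "(\<lambda>n. 1 / 2 * ((- ln (cmod (\<phi> n ?p))) powr (2 / a n) - (- ln (cmod (\<phi> n ?m))) powr (2 / a n)))
        \<longlonglongrightarrow> 1 / 2 * (1 / 2 * (?p \<bullet> (S *v ?p)) - 1 / 2 * (?m \<bullet> (S *v ?m)))"
      by (intro tendsto_intros power lim) auto
    also have "1 / 2 * (1 / 2 * (?p \<bullet> (S *v ?p)) - 1 / 2 * (?m \<bullet> (S *v ?m)))
        = 1 / 2 * (S $ i $ j + S $ j $ i)"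
      by (simp add: matrix_vector_right_distrib matrix_vector_mult_diff_distrib inner_add_left inner_add_right
        inner_diff_left inner_diff_right quadratic_form_std_basis) argo
    also have "S $ j $ i = transpose S $ i $ j"
      by (simp add: transpose_def)
    also have "transpose S = S"
      using S by (simp add: psd_matrix_def)
    finally show ?thesis
      using False by (simp add: Sigma_hat_def)
  qed
qed

text \<open>
  Every component of the stacked vectors is a finite sum of matrix entries, and both target
  spaces carry the topology of componentwise convergence.
\<close>

lemma tendsto_diag_vec_nd_vec:
  fixes A :: "nat \<Rightarrow> real ^ 'p::{finite,linorder} ^ 'p::{finite,linorder}"
  assumes a: "a \<longlonglongrightarrow> \<alpha>"
    and A: "\<And>i j. (\<lambda>n. A n $ i $ j) \<longlonglongrightarrow> S $ i $ j"
  shows "(\<lambda>n. (a n, diag_vec (A n), nd_vec (A n))) \<longlonglongrightarrow> (\<alpha>, diag_vec S, nd_vec S)"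
proof (intro tendsto_Pair a)
  show "(\<lambda>n. diag_vec (A n)) \<longlonglongrightarrow> diag_vec S"
    unfolding diag_vec_def by (intro tendsto_vec_lambda A)
  have "(\<lambda>n. nd_vec (A n) m) \<longlonglongrightarrow> nd_vec S m" for m
    unfolding nd_vec_def case_prod_beta by (intro tendsto_sum A)
  then show "(\<lambda>n. nd_vec (A n)) \<longlonglongrightarrow> nd_vec S"
    \<comment> \<open>The topology on functions is the product topology.\<close>
    unfolding limitin_canonical_iff[symmetric] euclidean_product_topology[symmetric]
    by (subst limitin_componentwise) simp
qed

section \<open>Strong consistency\<close>

text \<open>
  The set of evaluation points is finite, so one null set serves for all of them and for
  both choices of the plug-in estimator.
\<close>

theorem corollary2p5:
  fixes M :: "'a measure"
    and X :: "nat \<Rightarrow> 'a \<Rightarrow> real ^ 'p::{finite,linorder}"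
    and L :: "(real ^ 'p::{finite,linorder}) measure"
    and \<mu> :: "real ^ 'p::{finite,linorder}"
    and S :: "real ^ 'p::{finite,linorder} ^ 'p::{finite,linorder}"
    and \<alpha> s1 s2 :: real
    and \<sigma> :: "'p \<Rightarrow> real"
  assumes "prob_space M"
    and "0 < \<alpha>" and "\<alpha> < 2"
    and "psd_matrix S"
    and "sub_gaussian_stable \<mu> S \<alpha> L"
    and "prob_space.indep_vars M (\<lambda>_. borel) X {1..}"
    and "\<And>j. j \<ge> 1 \<Longrightarrow> distr M borel (X j) = L"
    and "\<And>i. \<sigma> i \<noteq> 0"
    and "s1 > 0" and "s2 > 0" and "s1 \<noteq> s2"
  shows
    "(ones \<bullet> (S *v ones) \<noteq> 0 \<longrightarrow>
       (AE \<omega> in M.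
         (\<lambda>n. let a = alpha_p s1 s2 (ecf X n \<omega>); Sh = Sigma_hat \<sigma> a (ecf X n \<omega>)
              in (a, diag_vec Sh, nd_vec Sh))
         \<longlonglongrightarrow> (\<alpha>, diag_vec S, nd_vec S)))
     \<and>
     ((\<forall>k. S $ k $ k \<noteq> 0) \<longrightarrow>
       (AE \<omega> in M.
         (\<lambda>n. let a = alpha_mult s1 s2 (ecf X n \<omega>); Sh = Sigma_hat \<sigma> a (ecf X n \<omega>)
              in (a, diag_vec Sh, nd_vec Sh))
         \<longlonglongrightarrow> (\<alpha>, diag_vec S, nd_vec S)))"
proof -
  interpret prob_space M by fact
  \<comment> \<open>The arguments at which the estimators evaluate the empirical characteristic function.\<close>
  define T :: "(real ^ 'p::{finite,linorder}) set" where
    "T = {s1 *\<^sub>R ones, s2 *\<^sub>R ones}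
       \<union> range (\<lambda>k. s1 *\<^sub>R std_basis k) \<union> range (\<lambda>k. s2 *\<^sub>R std_basis k)
       \<union> (range (\<lambda>i. \<sigma> i *\<^sub>R std_basis i)
         \<union> range (\<lambda>(i, j). std_basis i + std_basis j)
         \<union> range (\<lambda>(i, j). std_basis i - std_basis j))"
  have "countable T"
    unfolding T_def by (intro countable_finite) simp
  then have "AE \<omega> in M. \<forall>t\<in>T. (\<lambda>n. ecf X n \<omega> t) \<longlonglongrightarrow> cf L t"
    using ecf_tendsto_cf[OF assms(6,7)] by (subst AE_ball_countable) auto
  then have lim: "AE \<omega> in M. \<forall>t\<in>T. (\<lambda>n. - ln (cmod (ecf X n \<omega> t))) \<longlonglongrightarrow> stable_exponent S \<alpha> t"
  proof eventually_elim
    case (elim \<omega>)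
    then show ?case
      using neg_ln_norm_tendsto_stable_exponent[OF assms(5), where \<phi> = "\<lambda>n. ecf X n \<omega>"] by blast
  qed
  have plug_in: "(\<lambda>n. let Sh = Sigma_hat \<sigma> (a n) (ecf X n \<omega>) in (a n, diag_vec Sh, nd_vec Sh))
      \<longlonglongrightarrow> (\<alpha>, diag_vec S, nd_vec S)"
    if "\<forall>t\<in>T. (\<lambda>n. - ln (cmod (ecf X n \<omega> t))) \<longlonglongrightarrow> stable_exponent S \<alpha> t" "a \<longlonglongrightarrow> \<alpha>" for \<omega> a
    unfolding Let_def
  proof (rule tendsto_diag_vec_nd_vec[OF that(2) Sigma_hat_tendsto[OF assms(4,2) that(2) assms(8) norm_ecf_le_1]])
    fix t
    assume "t \<in> range (\<lambda>i. \<sigma> i *\<^sub>R std_basis i)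
       \<union> range (\<lambda>(i, j). std_basis i + std_basis j) \<union> range (\<lambda>(i, j). std_basis i - std_basis j)"
    then have "t \<in> T" unfolding T_def by blast
    then show "(\<lambda>n. - ln (cmod (ecf X n \<omega> t))) \<longlonglongrightarrow> stable_exponent S \<alpha> t"
      using that(1) by blast
  qed
  have along: "(\<lambda>n. alpha_along s1 s2 (ecf X n \<omega>) u) \<longlonglongrightarrow> \<alpha>"
    if "\<forall>t\<in>T. (\<lambda>n. - ln (cmod (ecf X n \<omega> t))) \<longlonglongrightarrow> stable_exponent S \<alpha> t"
      "u \<bullet> (S *v u) \<noteq> 0" "u \<in> insert ones (range std_basis)" for \<omega> u
  proof (rule alpha_along_tendsto[OF \<open>psd_matrix S\<close> that(2) \<open>s1 > 0\<close> \<open>s2 > 0\<close> \<open>s1 \<noteq> s2\<close>])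
    fix s assume "s \<in> {s1, s2}"
    then have "s *\<^sub>R u \<in> T" using that(3) unfolding T_def by auto
    then show "(\<lambda>n. - ln (cmod (ecf X n \<omega> (s *\<^sub>R u)))) \<longlonglongrightarrow> stable_exponent S \<alpha> (s *\<^sub>R u)"
      using that(1) by blast
  qed
  show ?thesis
  proof (intro conjI impI)
    assume nz: "ones \<bullet> (S *v ones) \<noteq> 0"
    show "AE \<omega> in M. (\<lambda>n. let a = alpha_p s1 s2 (ecf X n \<omega>); Sh = Sigma_hat \<sigma> a (ecf X n \<omega>)
        in (a, diag_vec Sh, nd_vec Sh)) \<longlonglongrightarrow> (\<alpha>, diag_vec S, nd_vec S)"
      using lim
    proof eventually_elim
      case (elim \<omega>)
      have "(\<lambda>n. alpha_p s1 s2 (ecf X n \<omega>)) \<longlonglongrightarrow> \<alpha>"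
        unfolding alpha_p_def using along[OF elim nz] by simp
      from plug_in[OF elim this] show ?case by (simp add: Let_def)
    qed
  next
    assume nz: "\<forall>k. S $ k $ k \<noteq> 0"
    show "AE \<omega> in M. (\<lambda>n. let a = alpha_mult s1 s2 (ecf X n \<omega>); Sh = Sigma_hat \<sigma> a (ecf X n \<omega>)
        in (a, diag_vec Sh, nd_vec Sh)) \<longlonglongrightarrow> (\<alpha>, diag_vec S, nd_vec S)"
      using lim
    proof eventually_elim
      case (elim \<omega>)
      have "(\<lambda>n. alpha_mult s1 s2 (ecf X n \<omega>)) \<longlonglongrightarrow> \<alpha>"
        using along[OF elim] nz by (intro alpha_mult_tendsto) (simp add: quadratic_form_std_basis)
      from plug_in[OF elim this] show ?case by (simp add: Let_def)
    qed
  qed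
qed

end
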